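(* Let $\varepsilon\ge 1$ be an integer. There exists an instance $I_2$ of the chance-constrained submodular problem of the following linear form: $V=\{1,\dots,n\}$ with $n\ge 2\varepsilon$, $0<\alpha<0.5$, $B=\varepsilon+1$, $f(X)=\sum_{i=1}^{\varepsilon}x_i+\varepsilon\sum_{i=\varepsilon+1}^{n}x_i$ (where $X=x_1\cdots x_n\in\{0,1\}^n$ encodes a subset of $V$, $x_i=1$ meaning that $i$ is selected), $\delta_i=\sqrt{\gamma/\varepsilon}$ for $1\le i\le\varepsilon$ and $\delta_j=\sqrt{(\varepsilon\gamma+\beta)/\varepsilon}$ for $\varepsilon+1\le j\le n$, with $\gamma>0$, $\beta>0$ and $\varepsilon\gamma+\beta\le 3\alpha/(1-\alpha)$, such that the generalized greedy+Max algorithm GGMA applying $h(S):=\sum_{i\in S}\delta_i^2$ fails to guarantee better than a $(2/\varepsilon-1/\varepsilon^2)$-approximation on $I_2$.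
   Context: Chance-constrained submodular problem: $V=\{1,\dots,n\}$; $f:2^V\to\mathbb{R}_{\ge 0}$ is monotone and submodular; the budget is $B>1$; the threshold is $\alpha\in[0,1]$ ($\alpha>0$ whenever $\kappa_\alpha$ below is used). Each element $i\in V$ has a random weight $w_i$, independently and uniformly distributed on $[1-\delta_i,1+\delta_i]$ with $0\le\delta_i\le 1$, so $E[w_i]=1$ and $Var[w_i]=\delta_i^2/3$. Write $W(S)=\sum_{i\in S}w_i$. The aim is to maximize $f(S)$ over $S\subseteq V$ subject to $\Pr[W(S)>B]\le\alpha$. Every single element is assumed feasible with respect to $B$. Surrogate weight: $\Gamma(S)=E[W(S)]+\kappa_\alpha\sqrt{Var[W(S)]}=|S|+\kappa_\alpha\sqrt{\sum_{i\in S}\delta_i^2/3}$, where $\kappa_\alpha=\sqrt{(1-\alpha)/\alpha}$. Algorithm GGMA (with a non-decreasing set function $h$): start with $T=\emptyset$, $S=\emptyset$, $V'=\{v\in V:\Gamma(\{v\})\le B\}$. While $V'\ne\emptyset$: let $v'\in\arg\max_{v\in V'}f(S\cup\{v\})$; if $f(T)<f(S\cup\{v'\})$, set $T\leftarrow S\cup\{v'\}$; then pick $v^*\in\arg\max_{v\in V'}\frac{f(S\cup\{v\})-f(S)}{h(S\cup\{v\})-h(S)}$, set $S\leftarrow S\cup\{v^*\}$, and update $V'\leftarrow\{v\in V'\setminus S:\Gamma(S\cup\{v\})\le B\}$. Output $T$. Let $OPT_d$ be an optimal solution of the deterministic instance, i.e. a maximizer of $f$ over sets of size at most $\lfloor B\rfloor$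 (all weights equal to $1$). An algorithm "fails to guarantee better than an $r$-approximation" on an instance if some possible output $T$ of it on that instance satisfies $f(T)\le r\cdot f(OPT_d)$. *)

theory Defs
  imports "HOL-Probability.Probability"
begin

record instance_data =
  num_items :: nat
  objective :: "nat set \<Rightarrow> real"
  budget :: real
  threshold :: real
  spread :: "nat \<Rightarrow> real"

definition items :: "instance_data \<Rightarrow> nat set" where
  "items I = {1..num_items I}"

text \<open>The uniform distribution on \<open>[1 - d, 1 + d]\<close>. The case \<open>d = 0\<close> is separate because
  \<^const>\<open>uniform_measure\<close> is not a probability measure on a null set.\<close>

definition weight_dist :: "real \<Rightarrow> real measure" where
  "weight_dist d = (if d = 0 then return borel 1 else uniform_measure lborel {1 - d..1 + d})"

definition weight_space :: "instance_data \<Rightarrow> (nat \<Rightarrow> real) measure" where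
  "weight_space I = (\<Pi>\<^sub>M i\<in>items I. weight_dist (spread I i))"

definition total_weight :: "nat set \<Rightarrow> (nat \<Rightarrow> real) \<Rightarrow> real" where
  "total_weight S w = (\<Sum>i\<in>S. w i)"

definition chance_feasible :: "instance_data \<Rightarrow> nat set \<Rightarrow> bool" where
  "chance_feasible I S \<longleftrightarrow>
     measure (weight_space I) {w \<in> space (weight_space I). total_weight S w > budget I}
       \<le> threshold I"

definition submodular_on :: "'a set \<Rightarrow> ('a set \<Rightarrow> real) \<Rightarrow> bool" where
  "submodular_on V f \<longleftrightarrow> (\<forall>A\<subseteq>V. \<forall>B\<subseteq>V. f (A \<union> B) + f (A \<inter> B) \<le> f A + f B)"

definition chance_constrained_instance :: "instance_data \<Rightarrow> bool" where
  "chance_constrained_instance I \<longleftrightarrow>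
     (\<forall>S\<subseteq>items I. 0 \<le> objective I S) \<and>
     mono_on (Pow (items I)) (objective I) \<and>
     submodular_on (items I) (objective I) \<and>
     1 < budget I \<and>
     0 \<le> threshold I \<and> threshold I \<le> 1 \<and>
     (\<forall>i\<in>items I. 0 \<le> spread I i \<and> spread I i \<le> 1) \<and>
     (\<forall>i\<in>items I. chance_feasible I {i})"

text \<open>\<open>kappa \<alpha>\<close> is meaningful for \<open>\<alpha> > 0\<close> only.\<close>

definition kappa :: "real \<Rightarrow> real" where
  "kappa \<alpha> = sqrt ((1 - \<alpha>) / \<alpha>)"

definition surrogate_weight :: "instance_data \<Rightarrow> nat set \<Rightarrow> real" where
  "surrogate_weight I S =
     prob_space.expectation (weight_space I) (total_weight S) +
     kappa (threshold I) * sqrt (prob_space.variance (weight_space I) (total_weight S))"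

lemma sets_weight_dist [measurable_cong]: "sets (weight_dist d) = sets borel"
  by (simp add: weight_dist_def)

lemma space_weight_dist [simp]: "space (weight_dist d) = UNIV"
  by (simp add: weight_dist_def)

lemma prob_space_weight_dist:
  assumes "0 \<le> d" shows "prob_space (weight_dist d)"
  using assms by (auto simp: weight_dist_def intro!: prob_space_return prob_space_uniform_measure)

lemma weight_dist_distributed:
  assumes "0 < d"
  shows "distributed (weight_dist d) lborel (\<lambda>x. x)
           (\<lambda>x. indicator {1 - d..1 + d} x / measure lborel {1 - d..1 + d})"
proof -
  have e: "emeasure lborel {1 - d..1 + d} = ennreal (2 * d)" using assms by simp
  have m: "measure lborel {1 - d..1 + d} = 2 * d" using assms by simp
  show ?thesis
    unfolding distributed_def weight_dist_def m
    using assms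
    apply (simp add: e uniform_measure_def del: emeasure_lborel_Icc_eq)
    apply (subst distr_id2)
     apply simp
    apply (rule density_cong)
      using divide_ennreal[of 1 "2 * d"] apply (auto simp: indicator_def)
    done
qed

lemma weight_dist_moments:
  assumes d: "0 \<le> d"
  shows "integral\<^sup>L (weight_dist d) (\<lambda>x. x) = 1"
    and "integral\<^sup>L (weight_dist d) (\<lambda>x. (x - 1)\<^sup>2) = d\<^sup>2 / 3"
proof -
  interpret prob_space "weight_dist d" by (rule prob_space_weight_dist[OF d])
  have "integral\<^sup>L (weight_dist d) (\<lambda>x. x) = 1 \<and>
        integral\<^sup>L (weight_dist d) (\<lambda>x. (x - 1)\<^sup>2) = d\<^sup>2 / 3"
  proof (cases "d = 0")
    case True
    then show ?thesis by (simp add: weight_dist_def integral_return)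
  next
    case False
    with d have D: "distributed (weight_dist d) lborel (\<lambda>x. x)
           (\<lambda>x. indicator {1 - d..1 + d} x / measure lborel {1 - d..1 + d})"
      by (intro weight_dist_distributed) auto
    have E: "expectation (\<lambda>x. x) = 1"
      using uniform_distributed_expectation[OF D] by simp
    show ?thesis
      using uniform_distributed_variance[OF D] unfolding E
      by (simp add: power2_eq_square)
  qed
  then show "integral\<^sup>L (weight_dist d) (\<lambda>x. x) = 1"
    "integral\<^sup>L (weight_dist d) (\<lambda>x. (x - 1)\<^sup>2) = d\<^sup>2 / 3" by auto
qed

lemma integrable_weight_dist:
  assumes d: "0 \<le> d" and f: "continuous_on UNIV (f :: real \<Rightarrow> real)"
  shows "integrable (weight_dist d) f"
proof -
  interpret prob_space "weight_dist d" by (rule prob_space_weight_dist[OF d])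
  obtain C where C: "\<And>x. x \<in> {1 - d..1 + d} \<Longrightarrow> \<bar>f x\<bar> \<le> C"
  proof -
    have "compact (f ` {1 - d..1 + d})"
      by (intro compact_continuous_image continuous_on_subset[OF f]) auto
    then have "bounded (f ` {1 - d..1 + d})" by (rule compact_imp_bounded)
    then show ?thesis using that unfolding bounded_iff by (metis image_eqI real_norm_def)
  qed
  have [measurable]: "f \<in> borel_measurable borel"
    by (rule borel_measurable_continuous_onI[OF f])
  have "AE x in weight_dist d. x \<in> {1 - d..1 + d}"
  proof (cases "d = 0")
    case True
    then have *: "weight_dist d = return borel 1" by (simp add: weight_dist_def)
    show ?thesis unfolding * by (subst AE_return) (use True in auto)
  next
    case False
    then have *: "weight_dist d = uniform_measure lborel {1 - d..1 + d}"
      by (simp add: weight_dist_def)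
    show ?thesis unfolding * by (rule AE_uniform_measureI) auto
  qed
  then have "AE x in weight_dist d. norm (f x) \<le> C" by eventually_elim (use C in auto)
  then show ?thesis
    by (rule integrable_const_bound) (simp add: measurable_cong_sets[OF sets_weight_dist refl])
qed

lemma surrogate_weight_eq:
  assumes sp: "\<And>i. i \<in> items I \<Longrightarrow> 0 \<le> spread I i" and S: "S \<subseteq> items I"
  shows "surrogate_weight I S =
    real (card S) + kappa (threshold I) * sqrt (\<Sum>i\<in>S. (spread I i)\<^sup>2 / 3)"
proof -
  define V where "V = items I"
  have fV [simp]: "finite V" by (simp add: V_def items_def)
  have fS [simp]: "finite S" using S fV finite_subset V_def by auto
  have SV: "S \<subseteq> V" using S by (simp add: V_def)
  define N where "N i = weight_dist (if i \<in> V then spread I i else 0)" for i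
  have nn: "0 \<le> (if i \<in> V then spread I i else 0)" for i using sp by (simp add: V_def)
  have pN: "prob_space (N i)" for i unfolding N_def by (rule prob_space_weight_dist[OF nn])
  interpret prod: product_prob_space N V
    by (rule product_prob_spaceI) (rule pN)
  have M: "weight_space I = Pi\<^sub>M V N"
    unfolding weight_space_def by (rule PiM_cong) (auto simp: V_def N_def)
  have int: "integrable (N i) f" if "continuous_on UNIV f" for i and f :: "real \<Rightarrow> real"
    unfolding N_def by (rule integrable_weight_dist[OF nn that])
  have e1: "integral\<^sup>L (N i) (\<lambda>x. x) = 1" for i
    unfolding N_def by (rule weight_dist_moments(1)[OF nn])
  have e2: "integral\<^sup>L (N i) (\<lambda>x. (x - 1)\<^sup>2) = (spread I i)\<^sup>2 / 3" if "i \<in> V" for i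
    unfolding N_def using weight_dist_moments(2)[OF nn, of i] that by simp
  have e0: "integral\<^sup>L (N i) (\<lambda>x. x - 1) = 0" for i
    by (subst Bochner_Integration.integral_diff) (auto intro!: int continuous_intros simp: e1 prod.M.prob_space)
  define g where "g i k x = (if k = i then x - 1 else 1)" for i k :: nat and x :: real
  have gc: "continuous_on UNIV (g i k)" for i k
    unfolding g_def by (cases "k = i") (auto intro!: continuous_intros)
  have gc2: "continuous_on UNIV (\<lambda>x. g i k x * g j k x)" for i j k
    by (intro continuous_intros gc)
  have g1: "(\<Prod>k\<in>V. g i k (w k)) = w i - 1" if "i \<in> V" for i w
    unfolding g_def using that by simp
  have single: "integrable (Pi\<^sub>M V N) (\<lambda>w. w i - 1)"
    "integral\<^sup>L (Pi\<^sub>M V N) (\<lambda>w. w i - 1) = 0" if i: "i \<in> V" for i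
  proof -
    show "integrable (Pi\<^sub>M V N) (\<lambda>w. w i - 1)"
      using prod.product_integrable_prod[OF fV, of "g i"] int[OF gc] by (simp add: g1[OF i])
    have "integral\<^sup>L (Pi\<^sub>M V N) (\<lambda>w. w i - 1) = (\<Prod>k\<in>V. integral\<^sup>L (N k) (g i k))"
      using prod.product_integral_prod[OF fV, of "g i"] int[OF gc] by (simp add: g1[OF i])
    also have "\<dots> = 0"
      using i by (intro prod_zero) (auto intro!: bexI[of _ i] simp: g_def[abs_def] e0)
    finally show "integral\<^sup>L (Pi\<^sub>M V N) (\<lambda>w. w i - 1) = 0" .
  qed
  have double: "integrable (Pi\<^sub>M V N) (\<lambda>w. (w i - 1) * (w j - 1))"
    "integral\<^sup>L (Pi\<^sub>M V N) (\<lambda>w. (w i - 1) * (w j - 1)) =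
       (if i = j then (spread I i)\<^sup>2 / 3 else 0)" if i: "i \<in> V" and j: "j \<in> V" for i j
  proof -
    have g2: "(\<Prod>k\<in>V. g i k (w k) * g j k (w k)) = (w i - 1) * (w j - 1)" for w
      by (simp add: prod.distrib g1 i j)
    show "integrable (Pi\<^sub>M V N) (\<lambda>w. (w i - 1) * (w j - 1))"
      using prod.product_integrable_prod[OF fV, of "\<lambda>k x. g i k x * g j k x"] int[OF gc2]
      by (simp add: g2)
    have "integral\<^sup>L (Pi\<^sub>M V N) (\<lambda>w. (w i - 1) * (w j - 1)) =
        (\<Prod>k\<in>V. integral\<^sup>L (N k) (\<lambda>x. g i k x * g j k x))"
      using prod.product_integral_prod[OF fV, of "\<lambda>k x. g i k x * g j k x"] int[OF gc2]
      by (simp add: g2)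
    also have "\<dots> = (if i = j then (spread I i)\<^sup>2 / 3 else 0)"
    proof (cases "i = j")
      case True
      have "(\<Prod>k\<in>V. integral\<^sup>L (N k) (\<lambda>x. g i k x * g j k x)) =
          (\<Prod>k\<in>V. if k = i then (spread I i)\<^sup>2 / 3 else 1)"
        using True e2[OF i] by (intro prod.cong) (auto simp: g_def power2_eq_square prod.M.prob_space)
      then show ?thesis using True i by simp
    next
      case False
      then show ?thesis
        using i by simp (auto intro!: bexI[of _ i] simp: g_def[abs_def] e0)
    qed
    finally show "integral\<^sup>L (Pi\<^sub>M V N) (\<lambda>w. (w i - 1) * (w j - 1)) =
       (if i = j then (spread I i)\<^sup>2 / 3 else 0)" .
  qed
  have tw: "total_weight S = (\<lambda>w. (\<Sum>i\<in>S. w i - 1) + real (card S))"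
    by (simp add: fun_eq_iff total_weight_def sum_subtractf)
  have isum: "integrable (Pi\<^sub>M V N) (\<lambda>w. \<Sum>i\<in>S. w i - 1)"
    by (rule Bochner_Integration.integrable_sum) (use single(1) SV in blast)
  have "integral\<^sup>L (Pi\<^sub>M V N) (total_weight S) =
      integral\<^sup>L (Pi\<^sub>M V N) (\<lambda>w. \<Sum>i\<in>S. w i - 1) + real (card S)"
    unfolding tw by (subst Bochner_Integration.integral_add[OF isum]) (auto simp: prod.P.prob_space)
  also have "integral\<^sup>L (Pi\<^sub>M V N) (\<lambda>w. \<Sum>i\<in>S. w i - 1) = 0"
  proof (subst Bochner_Integration.integral_sum)
    show "integrable (Pi\<^sub>M V N) (\<lambda>w. w i - 1)" if "i \<in> S" for i
      using single(1) SV that by blast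
    show "(\<Sum>i\<in>S. integral\<^sup>L (Pi\<^sub>M V N) (\<lambda>w. w i - 1)) = 0"
      using single(2) SV by (intro sum.neutral) blast
  qed
  finally have E: "integral\<^sup>L (Pi\<^sub>M V N) (total_weight S) = real (card S)" by simp
  have "integral\<^sup>L (Pi\<^sub>M V N) (\<lambda>w. (total_weight S w - real (card S))\<^sup>2) =
      integral\<^sup>L (Pi\<^sub>M V N) (\<lambda>w. \<Sum>i\<in>S. \<Sum>j\<in>S. (w i - 1) * (w j - 1))"
    by (simp add: tw power2_eq_square sum_product)
  also have "\<dots> = (\<Sum>i\<in>S. \<Sum>j\<in>S. if i = j then (spread I i)\<^sup>2 / 3 else 0)"
  proof -
    have "integral\<^sup>L (Pi\<^sub>M V N) (\<lambda>w. \<Sum>i\<in>S. \<Sum>j\<in>S. (w i - 1) * (w j - 1)) =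
        (\<Sum>i\<in>S. integral\<^sup>L (Pi\<^sub>M V N) (\<lambda>w. \<Sum>j\<in>S. (w i - 1) * (w j - 1)))"
      by (rule Bochner_Integration.integral_sum, rule Bochner_Integration.integrable_sum)
         (use double(1) SV in blast)
    also have "\<dots> = (\<Sum>i\<in>S. \<Sum>j\<in>S. integral\<^sup>L (Pi\<^sub>M V N) (\<lambda>w. (w i - 1) * (w j - 1)))"
      by (rule sum.cong[OF refl], rule Bochner_Integration.integral_sum)
         (use double(1) SV in blast)
    also have "\<dots> = (\<Sum>i\<in>S. \<Sum>j\<in>S. if i = j then (spread I i)\<^sup>2 / 3 else 0)"
      by (rule sum.cong[OF refl], rule sum.cong[OF refl], rule double(2)) (use SV in blast)+
    finally show ?thesis .
  qed
  also have "\<dots> = (\<Sum>i\<in>S. (spread I i)\<^sup>2 / 3)" by simp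
  finally show ?thesis by (simp add: surrogate_weight_def M E)
qed

text \<open>\<open>ggma_reachable I h S T R\<close>: at some evaluation of the loop guard, the current greedy set
  is \<open>S\<close>, the best set found so far is \<open>T\<close>, and \<open>R\<close> is the set of remaining candidates.
  Ties in either maximization are broken arbitrarily, so the relation is nondeterministic.\<close>

inductive ggma_reachable ::
    "instance_data \<Rightarrow> (nat set \<Rightarrow> real) \<Rightarrow> nat set \<Rightarrow> nat set \<Rightarrow> nat set \<Rightarrow> bool"
  for I :: instance_data and h :: "nat set \<Rightarrow> real" where
  start: "ggma_reachable I h {} {} {v \<in> items I. surrogate_weight I {v} \<le> budget I}"
| step: "\<lbrakk> ggma_reachable I h S T R;
      is_arg_max (\<lambda>v. objective I (S \<union> {v})) (\<lambda>v. v \<in> R) u;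
      T' = (if objective I T < objective I (S \<union> {u}) then S \<union> {u} else T);
      is_arg_max (\<lambda>v. (objective I (S \<union> {v}) - objective I S) / (h (S \<union> {v}) - h S))
        (\<lambda>v. v \<in> R) x;
      S' = S \<union> {x};
      R' = {v \<in> R - S'. surrogate_weight I (S' \<union> {v}) \<le> budget I} \<rbrakk>
    \<Longrightarrow> ggma_reachable I h S' T' R'"

definition ggma_output :: "instance_data \<Rightarrow> (nat set \<Rightarrow> real) \<Rightarrow> nat set \<Rightarrow> bool" where
  "ggma_output I h T \<longleftrightarrow> (\<exists>S. ggma_reachable I h S T {})"

definition deterministic_optimum :: "instance_data \<Rightarrow> nat set \<Rightarrow> bool" where
  "deterministic_optimum I X \<longleftrightarrow>
     is_arg_max (objective I) (\<lambda>Y. Y \<subseteq> items I \<and> int (card Y) \<le> \<lfloor>budget I\<rfloor>) X"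

text \<open>The algorithm is given by the predicate \<open>out\<close> describing its possible outputs.
  All deterministic optima have the same value, so it does not matter which one is taken.\<close>

definition fails_to_guarantee_better_than ::
    "instance_data \<Rightarrow> (nat set \<Rightarrow> bool) \<Rightarrow> real \<Rightarrow> bool" where
  "fails_to_guarantee_better_than I out r \<longleftrightarrow>
     (\<exists>T X. out T \<and> deterministic_optimum I X \<and> objective I T \<le> r * objective I X)"

lemma mono_sum_spread_squares: "mono_on (Pow (items I)) (\<lambda>S. \<Sum>i\<in>S. (spread I i)\<^sup>2)"
proof (rule mono_onI)
  fix A B assume "B \<in> Pow (items I)" "A \<subseteq> B"
  moreover from this have "finite B" by (auto simp: items_def dest: finite_subset)
  ultimately show "(\<Sum>i\<in>A. (spread I i)\<^sup>2) \<le> (\<Sum>i\<in>B. (spread I i)\<^sup>2)"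
    by (intro sum_mono2) auto
qed

end

theory Submission
  imports Defs
begin

text \<open>Take \<open>n = 2\<epsilon>\<close>, \<open>\<alpha> = 1/4\<close> (so that \<open>\<kappa>\<^sub>\<alpha>\<^sup>2 = 3\<close> and the surrogate weight of \<open>S\<close> is
  \<open>card S + sqrt (\<Sum>i\<in>S. \<delta>\<^sub>i\<^sup>2)\<close>), \<open>\<gamma> = 1/(2\<epsilon>)\<close> and \<open>\<beta> = 1/2\<close>. An item of value \<open>1\<close> has density
  \<open>2\<epsilon>\<^sup>2\<close> and an item of value \<open>\<epsilon>\<close> only \<open>\<epsilon>\<^sup>2\<close>, so the greedy set collects all the items of value
  \<open>1\<close> first. After that every further item pushes the surrogate weight above \<open>\<epsilon> + 1\<close>. Hence every
  set evaluated by the algorithm has value at most \<open>(\<epsilon> - 1) + \<epsilon>\<close>, while the \<open>\<epsilon>\<close> items of value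
  \<open>\<epsilon>\<close> together are worth \<open>\<epsilon>\<^sup>2\<close>.\<close>

lemma finite_ex_is_arg_max:
  fixes f :: "'a \<Rightarrow> 'b :: linorder"
  assumes "finite {x. P x}" "P a"
  shows "\<exists>x. is_arg_max f P x"
proof -
  have ne: "f ` {x. P x} \<noteq> {}" using assms(2) by auto
  have fin: "finite (f ` {x. P x})" using assms(1) by simp
  obtain x where "P x" "f x = Max (f ` {x. P x})"
    using Max_in[OF fin ne] by auto
  with fin show ?thesis by (auto simp: is_arg_max_linorder)
qed

lemma AE_weight_dist_le:
  assumes "0 \<le> d"
  shows "AE x in weight_dist d. x \<le> 1 + d"
proof (cases "d = 0")
  case True
  then have *: "weight_dist d = return borel 1" by (simp add: weight_dist_def)
  show ?thesis unfolding * by (subst AE_return) (use True in auto)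
next
  case False
  then have *: "weight_dist d = uniform_measure lborel {1 - d..1 + d}"
    by (simp add: weight_dist_def)
  show ?thesis unfolding * by (rule AE_uniform_measureI) auto
qed

text \<open>Almost surely the weight of \<open>i\<close> is at most \<open>1 + spread I i\<close>,
  so exceeding the budget is a null event, acceptable at every nonnegative threshold.\<close>

lemma chance_feasible_singleton:
  assumes i: "i \<in> items I" and spread: "\<And>j. j \<in> items I \<Longrightarrow> 0 \<le> spread I j"
    and budget: "1 + spread I i \<le> budget I" and threshold: "0 \<le> threshold I"
  shows "chance_feasible I {i}"
proof -
  have "AE w in weight_space I. w i \<le> 1 + spread I i"
    unfolding weight_space_def
    by (rule AE_PiM_component[where P = "\<lambda>x. x \<le> 1 + spread I i"])
       (use i spread in \<open>auto intro: prob_space_weight_dist AE_weight_dist_le\<close>)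
  then have "AE w in weight_space I. \<not> total_weight {i} w > budget I"
    by eventually_elim (use budget in \<open>simp add: total_weight_def\<close>)
  then have "measure (weight_space I) {w \<in> space (weight_space I). total_weight {i} w > budget I} = 0"
    by (simp add: measure_def emeasure_eq_0_AE)
  then show ?thesis using threshold by (simp add: chance_feasible_def)
qed

definition item_value :: "nat \<Rightarrow> nat \<Rightarrow> real" where
  "item_value e i = (if i \<le> e then 1 else real e)"

text \<open>The squared spreads for \<gamma> = 1/(2\<epsilon>) and \<beta> = 1/2. Working with
  squares keeps roots out of \<open>h\<close> and of the densities.\<close>

definition spread_sq :: "nat \<Rightarrow> nat \<Rightarrow> real" where
  "spread_sq e i = (if i \<le> e then 1 / (2 * (real e)\<^sup>2) else 1 / real e)"

definition hard_instance :: "nat \<Rightarrow> instance_data" where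
  "hard_instance e = \<lparr>num_items = 2 * e, objective = sum (item_value e),
     budget = real e + 1, threshold = 1 / 4, spread = (\<lambda>i. sqrt (spread_sq e i))\<rparr>"

lemma hard_instance_simps [simp]:
  "num_items (hard_instance e) = 2 * e"
  "objective (hard_instance e) = sum (item_value e)"
  "budget (hard_instance e) = real e + 1"
  "threshold (hard_instance e) = 1 / 4"
  "spread (hard_instance e) = (\<lambda>i. sqrt (spread_sq e i))"
  "items (hard_instance e) = {1..2 * e}"
  by (simp_all add: hard_instance_def items_def)

lemma item_value_nonneg [simp]: "0 \<le> item_value e i"
  by (simp add: item_value_def)

lemma spread_sq_nonneg [simp]: "0 \<le> spread_sq e i"
  by (simp add: spread_sq_def)

lemma item_value_le: "1 \<le> e \<Longrightarrow> item_value e i \<le> real e"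
  by (simp add: item_value_def)

lemma spread_sq_le:
  assumes "1 \<le> e" shows "spread_sq e i \<le> 1 / real e"
proof -
  have "real e * 1 \<le> real e * (2 * real e)" using assms by (intro mult_left_mono) auto
  then show ?thesis using assms by (simp add: spread_sq_def field_simps power2_eq_square)
qed

lemma spread_sq_le_1: "1 \<le> e \<Longrightarrow> spread_sq e i \<le> 1"
  using spread_sq_le[of e i] by (rule order_trans) simp_all

text \<open>Writing membership as a 0/1 factor extends the sum to all items, which then splits at
  \<open>e\<close> into the two kinds.\<close>

lemma sum_item_value:
  assumes "X \<subseteq> {1..2 * e}"
  shows "sum (item_value e) X =
    (\<Sum>i = 1..e. of_bool (i \<in> X)) + real e * (\<Sum>i = e + 1..2 * e. of_bool (i \<in> X))"
proof -
  have "sum (item_value e) X = (\<Sum>i = 1..2 * e. item_value e i * of_bool (i \<in> X))"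
    using assms by (intro sum.mono_neutral_cong_left) auto
  also have "{1..2 * e} = {1..e} \<union> {e + 1..2 * e}" by auto
  also have "(\<Sum>i\<in>\<dots>. item_value e i * of_bool (i \<in> X)) =
      (\<Sum>i = 1..e. item_value e i * of_bool (i \<in> X)) +
      (\<Sum>i = e + 1..2 * e. item_value e i * of_bool (i \<in> X))"
    by (rule sum.union_disjoint) auto
  finally show ?thesis
    by (simp add: item_value_def sum_distrib_left)
qed

text \<open>At threshold 1/4, \<open>kappa\<close> equals \<open>sqrt 3\<close>, which cancels the
  factor 1/3 in each variance.\<close>

lemma surrogate_weight_hard_instance:
  assumes "S \<subseteq> {1..2 * e}"
  shows "surrogate_weight (hard_instance e) S = real (card S) + sqrt (sum (spread_sq e) S)"
proof -
  have "surrogate_weight (hard_instance e) S =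
      real (card S) + sqrt 3 * sqrt (\<Sum>i\<in>S. spread_sq e i / 3)"
    by (subst surrogate_weight_eq) (use assms in \<open>simp_all add: kappa_def\<close>)
  also have "sqrt 3 * sqrt (\<Sum>i\<in>S. spread_sq e i / 3) = sqrt (sum (spread_sq e) S)"
    by (simp flip: real_sqrt_mult sum_divide_distrib)
  finally show ?thesis .
qed

text \<open>The objective is additive, so submodularity holds with equality. Spreads at most 1 and a
  budget of at least 2 make single items feasible.\<close>

lemma chance_constrained_hard_instance:
  assumes "1 \<le> e"
  shows "chance_constrained_instance (hard_instance e)"
proof -
  have "chance_feasible (hard_instance e) {i}" if "i \<in> {1..2 * e}" for i
  proof (rule chance_feasible_singleton)
    have "sqrt (spread_sq e i) \<le> 1" using spread_sq_le_1[OF assms] by simp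
    then show "1 + spread (hard_instance e) i \<le> budget (hard_instance e)"
      using assms by (simp del: real_sqrt_le_1_iff)
  qed (use that in simp_all)
  moreover have "submodular_on {1..2 * e} (sum (item_value e))"
    unfolding submodular_on_def
    by (auto intro!: eq_refl sum.union_inter dest: finite_subset)
  moreover have "mono_on (Pow {1..2 * e}) (sum (item_value e))"
    by (intro mono_onI sum_mono2) (auto dest: finite_subset)
  ultimately show ?thesis
    using assms by (simp add: chance_constrained_instance_def sum_nonneg spread_sq_le_1)
qed

text \<open>The set has \<open>k + 1\<close> elements, so its surrogate weight is
  \<open>k + 1 + sqrt q\<close> with \<open>0 < q\<close>. For \<open>k = e\<close> the positive
  root overshoots the budget; for \<open>k < e\<close> it suffices that
  \<open>q \<le> 1\<close>.\<close>

lemma surrogate_weight_prefix: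
  assumes "1 \<le> e" "k \<le> e" and v: "v \<in> {1..2 * e} - {1..k}"
  shows "surrogate_weight (hard_instance e) (insert v {1..k}) \<le> real e + 1 \<longleftrightarrow> k < e"
proof -
  define q where "q = sum (spread_sq e) (insert v {1..k})"
  have q: "q = spread_sq e v + real k / (2 * (real e)\<^sup>2)"
    using v assms(2) by (simp add: q_def spread_sq_def)
  have w: "surrogate_weight (hard_instance e) (insert v {1..k}) = real k + 1 + sqrt q"
    using v assms(2) by (subst surrogate_weight_hard_instance) (auto simp: q_def)
  have "0 < q" using assms(1) by (auto simp: q spread_sq_def intro!: add_pos_nonneg)
  moreover have "q \<le> 1" if "k < e"
  proof -
    \<comment> \<open>An item \<open>v\<close> of either kind contributes at most
      \<open>1 / e\<close> to \<open>q\<close>, which leaves this share of 1 for the prefix.\<close>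
    have "real k / (2 * (real e)\<^sup>2) \<le> (real e - 1) / real e"
    proof -
      have "real k \<le> real e - 1" using that by simp
      moreover have "real e * 1 \<le> real e * (2 * real e)"
        using assms(1) by (intro mult_left_mono) auto
      ultimately show ?thesis
        using assms(1) by (intro frac_le) (auto simp: power2_eq_square)
    qed
    then show ?thesis
      using spread_sq_le[OF assms(1), of v] assms(1) by (simp add: q diff_divide_distrib)
  qed
  moreover have "real k + 1 \<le> real e" if "k < e" using that by simp
  moreover have "q \<le> 1 \<Longrightarrow> sqrt q \<le> 1" "0 < q \<Longrightarrow> 0 < sqrt q" by simp_all
  moreover have "real k = real e" if "\<not> k < e" using that assms(2) by simp
  ultimately show ?thesis unfolding w by linarith
qed

text \<open>All remaining items of value 1 tie for the highest density. Choosing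
  \<open>Suc k\<close> among them is a legal tie-break and keeps the greedy set an initial
  segment.\<close>

lemma is_arg_max_density_prefix:
  assumes "1 \<le> e" "k < e"
  shows "is_arg_max (\<lambda>v. (sum (item_value e) ({1..k} \<union> {v}) - sum (item_value e) {1..k}) /
      (sum (spread_sq e) ({1..k} \<union> {v}) - sum (spread_sq e) {1..k}))
    (\<lambda>v. v \<in> {1..2 * e} - {1..k}) (Suc k)"
proof -
  have "Suc k \<in> {1..2 * e} - {1..k}" using assms by auto
  then show ?thesis
    unfolding is_arg_max_linorder using assms(2)
    by (auto simp: item_value_def spread_sq_def power2_eq_square)
qed

text \<open>Induction along one possible run, which is enough since failure only asks for some
  output. At \<open>k = e\<close> no candidate remains, so \<open>T\<close> is then an
  output.\<close>

lemma ggma_reachable_hard_instance: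
  assumes "1 \<le> e" "k \<le> e"
  shows "\<exists>T. ggma_reachable (hard_instance e) (sum (spread_sq e)) {1..k} T
      (if k < e then {1..2 * e} - {1..k} else {}) \<and> sum (item_value e) T \<le> 2 * real e - 1"
  using assms(2)
proof (induction k)
  case 0
  have "{v \<in> {1..2 * e}. surrogate_weight (hard_instance e) {v} \<le> real e + 1} = {1..2 * e}"
    using surrogate_weight_prefix[OF assms(1), of 0] assms(1) by auto
  then show ?case
    using ggma_reachable.start[of "hard_instance e" "sum (spread_sq e)"] assms(1)
    by (intro exI[of _ "{}"]) simp
next
  case (Suc k)
  define R where "R = {1..2 * e} - {1..k}"
  obtain T where T: "ggma_reachable (hard_instance e) (sum (spread_sq e)) {1..k} T R"
      "sum (item_value e) T \<le> 2 * real e - 1"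
    using Suc by (auto simp: R_def)
  have "Suc k \<in> R" "finite {v. v \<in> R}" using Suc.prems by (auto simp: R_def)
  then obtain u where u: "is_arg_max (\<lambda>v. sum (item_value e) ({1..k} \<union> {v})) (\<lambda>v. v \<in> R) u"
    using finite_ex_is_arg_max by metis
  then have "u \<in> R" by (simp add: is_arg_max_def)
  then have "sum (item_value e) ({1..k} \<union> {u}) = item_value e u + real k"
    using Suc.prems by (simp add: R_def item_value_def)
  \<comment> \<open>The candidate is evaluated before the greedy set grows, so at most
    \<open>e - 1\<close> items of value 1 accompany \<open>u\<close>.\<close>
  also have "\<dots> \<le> 2 * real e - 1"
    using item_value_le[OF assms(1), of u] Suc.prems by simp
  finally have value_u: "sum (item_value e) ({1..k} \<union> {u}) \<le> 2 * real e - 1" .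
  define T' where
    "T' = (if sum (item_value e) T < sum (item_value e) ({1..k} \<union> {u}) then {1..k} \<union> {u} else T)"
  have prefix: "{1..k} \<union> {Suc k} = {1..Suc k}" by auto
  have rest: "{v \<in> R - {1..Suc k}.
      surrogate_weight (hard_instance e) ({1..Suc k} \<union> {v}) \<le> real e + 1} =
      (if Suc k < e then {1..2 * e} - {1..Suc k} else {})"
    using surrogate_weight_prefix[OF assms(1) Suc.prems] by (auto simp: R_def)
  have "ggma_reachable (hard_instance e) (sum (spread_sq e)) {1..Suc k} T'
      (if Suc k < e then {1..2 * e} - {1..Suc k} else {})"
    using is_arg_max_density_prefix[OF assms(1), of k] Suc.prems
    by (intro ggma_reachable.step[OF T(1), where u = u and x = "Suc k"])
       (simp_all only: hard_instance_simps prefix rest T'_def u R_def[symmetric] Suc_le_eq)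
  moreover have "sum (item_value e) T' \<le> 2 * real e - 1"
    using T(2) value_u by (simp add: T'_def)
  ultimately show ?case by blast
qed

text \<open>An optimum exists by finiteness, and it is compared with the block of \<open>e\<close>
  items of value \<open>e\<close>. The cardinality bound is \<open>e + 1\<close>, so only a lower
  bound is claimed.\<close>

lemma deterministic_optimum_hard_instance:
  obtains X where "deterministic_optimum (hard_instance e) X" "(real e)\<^sup>2 \<le> sum (item_value e) X"
proof -
  define P where "P Y \<longleftrightarrow> Y \<subseteq> {1..2 * e} \<and> int (card Y) \<le> \<lfloor>real e + 1\<rfloor>" for Y
  have P: "P {e + 1..2 * e}" by (auto simp: P_def)
  have "finite {Y. P Y}"
    by (rule finite_subset[of _ "Pow {1..2 * e}"]) (auto simp: P_def)
  then obtain X where X: "is_arg_max (sum (item_value e)) P X"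
    using finite_ex_is_arg_max P by metis
  have "(real e)\<^sup>2 = sum (item_value e) {e + 1..2 * e}"
    by (simp add: item_value_def power2_eq_square)
  also have "\<dots> \<le> sum (item_value e) X"
    using X P by (auto simp: is_arg_max_linorder)
  finally show thesis
    using that X by (simp add: deterministic_optimum_def P_def[abs_def])
qed

lemma ggma_fails_hard_instance:
  assumes "1 \<le> e"
  shows "fails_to_guarantee_better_than (hard_instance e)
    (ggma_output (hard_instance e) (sum (spread_sq e))) (2 / real e - 1 / (real e)\<^sup>2)"
proof -
  obtain T where T: "ggma_output (hard_instance e) (sum (spread_sq e)) T"
      "sum (item_value e) T \<le> 2 * real e - 1"
    using ggma_reachable_hard_instance[OF assms order_refl] by (auto simp: ggma_output_def)
  obtain X where X: "deterministic_optimum (hard_instance e) X"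
      "(real e)\<^sup>2 \<le> sum (item_value e) X"
    by (rule deterministic_optimum_hard_instance)
  have r: "2 / real e - 1 / (real e)\<^sup>2 = (2 * real e - 1) / (real e)\<^sup>2"
    using assms by (simp add: field_simps power2_eq_square)
  have "2 * real e - 1 = (2 / real e - 1 / (real e)\<^sup>2) * (real e)\<^sup>2"
    using assms by (simp add: r)
  \<comment> \<open>Monotonicity requires a nonnegative ratio; the form in \<open>r\<close> shows
    this, as \<open>2 * e - 1\<close> is positive.\<close>
  also have "\<dots> \<le> (2 / real e - 1 / (real e)\<^sup>2) * sum (item_value e) X"
    using assms X(2) by (intro mult_left_mono) (simp_all add: r)
  finally show ?thesis
    using T X(1) unfolding fails_to_guarantee_better_than_def hard_instance_simps by (meson order_trans)
qed

theorem theorem5: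
  fixes \<epsilon> :: nat
  assumes "1 \<le> \<epsilon>"
  shows "\<exists>(I :: instance_data) (n :: nat) (\<alpha> :: real) (\<gamma> :: real) (\<beta> :: real).
    chance_constrained_instance I \<and>
    num_items I = n \<and> 2 * \<epsilon> \<le> n \<and>
    threshold I = \<alpha> \<and> 0 < \<alpha> \<and> \<alpha> < 1 / 2 \<and>
    budget I = real \<epsilon> + 1 \<and>
    (\<forall>X\<subseteq>items I. objective I X =
       (\<Sum>i = 1..\<epsilon>. of_bool (i \<in> X)) + real \<epsilon> * (\<Sum>i = \<epsilon> + 1..n. of_bool (i \<in> X))) \<and>
    0 < \<gamma> \<and> 0 < \<beta> \<and> real \<epsilon> * \<gamma> + \<beta> \<le> 3 * \<alpha> / (1 - \<alpha>) \<and>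
    (\<forall>i\<in>{1..\<epsilon>}. spread I i = sqrt (\<gamma> / real \<epsilon>)) \<and>
    (\<forall>j\<in>{\<epsilon> + 1..n}. spread I j = sqrt ((real \<epsilon> * \<gamma> + \<beta>) / real \<epsilon>)) \<and>
    fails_to_guarantee_better_than I
      (ggma_output I (\<lambda>S. \<Sum>i\<in>S. (spread I i)\<^sup>2))
      (2 / real \<epsilon> - 1 / (real \<epsilon>)\<^sup>2)"
proof (intro exI conjI)
  let ?I = "hard_instance \<epsilon>"
  \<comment> \<open>These values give \<epsilon>\<gamma> + \<beta> = 1, which is 3\<alpha>/(1 -
    \<alpha>) at \<alpha> = 1/4: the constraint holds with equality.\<close>
  let ?\<gamma> = "1 / (2 * real \<epsilon>)" and ?\<beta> = "1 / 2 :: real"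
  show "chance_constrained_instance ?I"
    by (rule chance_constrained_hard_instance[OF assms])
  show "num_items ?I = 2 * \<epsilon>" "threshold ?I = 1 / 4" "budget ?I = real \<epsilon> + 1"
    by simp_all
  show "\<forall>X\<subseteq>items ?I. objective ?I X =
      (\<Sum>i = 1..\<epsilon>. of_bool (i \<in> X)) + real \<epsilon> * (\<Sum>i = \<epsilon> + 1..2 * \<epsilon>. of_bool (i \<in> X))"
    using sum_item_value by simp
  show "real \<epsilon> * ?\<gamma> + ?\<beta> \<le> 3 * (1 / 4) / (1 - 1 / 4)"
    using assms by simp
  show "\<forall>i\<in>{1..\<epsilon>}. spread ?I i = sqrt (?\<gamma> / real \<epsilon>)"
    by (simp add: spread_sq_def power2_eq_square)
  show "\<forall>j\<in>{\<epsilon> + 1..2 * \<epsilon>}. spread ?I j = sqrt ((real \<epsilon> * ?\<gamma> + ?\<beta>) / real \<epsilon>)"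
    using assms by (simp add: spread_sq_def)
  show "fails_to_guarantee_better_than ?I (ggma_output ?I (\<lambda>S. \<Sum>i\<in>S. (spread ?I i)\<^sup>2))
      (2 / real \<epsilon> - 1 / (real \<epsilon>)\<^sup>2)"
    using ggma_fails_hard_instance[OF assms] by simp
qed (use assms in simp_all)

end
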